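(* Let $G=(V,E)$ be an undirected (multi-)graph on $n$ vertices and let $k\geq 1$ be an integer. Let $r := 200k^2\ln n$. For each $i=1,\ldots,r$ independently, let $V_i\subseteq V$ be a random subset in which each vertex of $V$ is included independently with probability $1/k$, let $G_i=G[V_i]$ be the subgraph of $G$ induced on $V_i$, and let $T_i$ be an arbitrary spanning forest of $G_i$. Let $H := T_1\cup T_2\cup\cdots\cup T_r$, viewed as a subgraph of $G$ on vertex set $V$. Then with high probability, $H$ has $O(kn\log n)$ edges and $H$ is a certificate of $k$-vertex-connectivity for $G$.
   Context: The vertex connectivity of an undirected graph is the minimum number of vertices whose removal disconnects the graph or leaves a single vertex; the graph is $k$-vertex-connected if its vertex connectivity is at least $k$. A certificate of $k$-vertex-connectivity for $G=(V,E)$ is a subgraph $H=(V,E_H)$ on the same vertex set such that $G$ is $k$-vertex-connected if and only if $H$ is $k$-vertex-connected. "With high probability" means with probability at least $1-1/n^c$ for some constant $c>0$. *)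

theory Defs
  imports "HOL-Probability.Probability"
begin

text \<open>
  Undirected multigraphs: edges are abstract objects, so two edges may have the same set of
  ends. An edge with a single end is a loop; loops are allowed.
\<close>

record ('v, 'e) mgraph =
  verts :: "'v set"
  edges :: "'e set"
  ends :: "'e \<Rightarrow> 'v set"

definition finite_mgraph :: "('v, 'e) mgraph \<Rightarrow> bool" where
  "finite_mgraph G \<longleftrightarrow> finite (verts G) \<and> finite (edges G) \<and>
     (\<forall>e\<in>edges G. \<exists>u\<in>verts G. \<exists>v\<in>verts G. ends G e = {u, v})"

definition subgraph :: "('v, 'e) mgraph \<Rightarrow> ('v, 'e) mgraph \<Rightarrow> bool" where
  "subgraph H G \<longleftrightarrow> verts H \<subseteq> verts G \<and> edges H \<subseteq> edges G \<and>
     (\<forall>e\<in>edges H. ends H e = ends G e \<and> ends H e \<subseteq> verts H)"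

definition induced :: "('v, 'e) mgraph \<Rightarrow> 'v set \<Rightarrow> ('v, 'e) mgraph" where
  "induced G W = \<lparr>verts = W, edges = {e \<in> edges G. ends G e \<subseteq> W}, ends = ends G\<rparr>"

definition walk :: "('v, 'e) mgraph \<Rightarrow> 'v list \<Rightarrow> 'e list \<Rightarrow> bool" where
  "walk G vs es \<longleftrightarrow> length vs = Suc (length es) \<and> set vs \<subseteq> verts G \<and> set es \<subseteq> edges G \<and>
     (\<forall>i<length es. ends G (es ! i) = {vs ! i, vs ! Suc i})"

definition reachable :: "('v, 'e) mgraph \<Rightarrow> 'v \<Rightarrow> 'v \<Rightarrow> bool" where
  "reachable G u v \<longleftrightarrow> (\<exists>vs es. walk G vs es \<and> hd vs = u \<and> last vs = v)"

definition connected_mgraph :: "('v, 'e) mgraph \<Rightarrow> bool" where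
  "connected_mgraph G \<longleftrightarrow> (\<forall>u\<in>verts G. \<forall>v\<in>verts G. reachable G u v)"

text \<open>A loop is a cycle of length 1 and a pair of parallel edges a cycle of length 2.\<close>

definition cycle :: "('v, 'e) mgraph \<Rightarrow> 'v list \<Rightarrow> 'e list \<Rightarrow> bool" where
  "cycle G vs es \<longleftrightarrow> walk G vs es \<and> es \<noteq> [] \<and> hd vs = last vs \<and> distinct (tl vs) \<and> distinct es"

definition forest :: "('v, 'e) mgraph \<Rightarrow> bool" where
  "forest G \<longleftrightarrow> (\<nexists>vs es. cycle G vs es)"

text \<open>
  A spanning forest of \<open>G\<close> consists of a spanning tree of each connected component of \<open>G\<close>:
  it is not merely an acyclic subgraph on all the vertices.
\<close>

definition spanning_forest :: "('v, 'e) mgraph \<Rightarrow> ('v, 'e) mgraph \<Rightarrow> bool" where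
  "spanning_forest T G \<longleftrightarrow> subgraph T G \<and> verts T = verts G \<and> forest T \<and>
     (\<forall>u v. reachable G u v \<longrightarrow> reachable T u v)"

text \<open>
  The graph without vertices counts as connected, so removing all vertices does not
  disconnect a graph. If \<open>G\<close> has a vertex, then the minimum is over a nonempty set.
\<close>

definition vertex_connectivity :: "('v, 'e) mgraph \<Rightarrow> nat" where
  "vertex_connectivity G = (LEAST m. \<exists>S\<subseteq>verts G. card S = m \<and>
     (\<not> connected_mgraph (induced G (verts G - S)) \<or> card (verts G - S) = 1))"

definition k_vertex_connected :: "nat \<Rightarrow> ('v, 'e) mgraph \<Rightarrow> bool" where
  "k_vertex_connected k G \<longleftrightarrow> k \<le> vertex_connectivity G"

definition certificate :: "nat \<Rightarrow> ('v, 'e) mgraph \<Rightarrow> ('v, 'e) mgraph \<Rightarrow> bool" where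
  "certificate k G H \<longleftrightarrow> subgraph H G \<and> verts H = verts G \<and>
     (k_vertex_connected k G \<longleftrightarrow> k_vertex_connected k H)"

definition random_subset :: "'v set \<Rightarrow> real \<Rightarrow> 'v set pmf" where
  "random_subset V p =
     map_pmf (\<lambda>b. {v \<in> V. b v}) (Pi_pmf V False (\<lambda>_. bernoulli_pmf p))"

definition random_subsets :: "nat \<Rightarrow> 'v set \<Rightarrow> real \<Rightarrow> (nat \<Rightarrow> 'v set) pmf" where
  "random_subsets r V p = Pi_pmf {1..r} {} (\<lambda>_. random_subset V p)"

text \<open>The number of samples must be an integer, hence the rounding up.\<close>

definition num_samples :: "nat \<Rightarrow> nat \<Rightarrow> nat" where
  "num_samples k n = nat \<lceil>200 * real k ^ 2 * ln (real n)\<rceil>"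

definition union_subgraph :: "('v, 'e) mgraph \<Rightarrow> nat \<Rightarrow> (nat \<Rightarrow> ('v, 'e) mgraph) \<Rightarrow> ('v, 'e) mgraph" where
  "union_subgraph G r T = \<lparr>verts = verts G, edges = (\<Union>i\<in>{1..r}. edges (T i)), ends = ends G\<rparr>"

end

theory Submission imports Defs begin

text \<open>
  Menger's theorem is avoided as follows. With high probability two properties hold.
  First, for all sets \<open>X\<close> of fewer than \<open>k\<close> vertices, fewer than \<open>k\<close> pairs of vertices
  outside \<open>X\<close> are contained in no sample avoiding \<open>X\<close>: one sample avoids \<open>X\<close> and contains
  one of \<open>k\<close> given pairs with probability at least \<open>1 / (6 k)\<close>, so \<open>200 k\<^sup>2 ln n\<close> samples leave
  room for a union bound over all \<open>n\<^bsup>3k\<^esup>\<close> choices of \<open>X\<close> and the pairs.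
  Second, if \<open>u\<close> and \<open>v\<close> can be separated, up to the edges between them, by at most \<open>2 (k - 1)\<close>
  vertices, then for a fixed such separator \<open>Y\<close> some sample contains \<open>u\<close> and \<open>v\<close> and avoids \<open>Y\<close>,
  so that the spanning forest of this sample contains an edge between \<open>u\<close> and \<open>v\<close>.

  Suppose that \<open>G\<close> is \<open>k\<close>-vertex-connected but \<open>H - X\<close> is disconnected with \<open>|X| < k\<close>, and
  let \<open>A\<close> be one of its components. The ends of an edge of \<open>G - X\<close> leaving \<open>A\<close> lie in no common
  sample avoiding \<open>X\<close>, so by the first property these ends form fewer than \<open>k\<close> pairs. Fix such a
  pair \<open>u v\<close>. Adding to \<open>X\<close> one end, other than \<open>u\<close> and \<open>v\<close>, of each of the other pairs gives a
  separator of \<open>u\<close> and \<open>v\<close> of size at most \<open>2 (k - 1)\<close>, so by the second property an edge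
  between \<open>u\<close> and \<open>v\<close> belongs to \<open>H - X\<close>, a contradiction.

  The number of edges of \<open>H\<close> is at most the total size of the samples, whose upper tail is bounded
  by Markov's inequality for \<open>2\<close> raised to that size.
\<close>

subsection \<open>Walks and forests\<close>

lemma reachable_refl: "u \<in> verts G \<Longrightarrow> reachable G u u"
  unfolding reachable_def walk_def by (intro exI[of _ "[u]"] exI[of _ "[]"]) auto

lemma reachable_step:
  assumes "reachable G u a" "e \<in> edges G" "ends G e = {a, b}" "b \<in> verts G"
  shows "reachable G u b"
proof -
  obtain vs es where w: "walk G vs es" "hd vs = u" "last vs = a"
    using assms(1) unfolding reachable_def by auto
  have ne: "vs \<noteq> []" and len: "length vs = Suc (length es)"
    using w(1) unfolding walk_def by auto
  have last: "vs ! length es = a"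
    using w(3) ne len by (simp add: last_conv_nth)
  have "walk G (vs @ [b]) (es @ [e])"
    using w(1) assms last unfolding walk_def
    by (auto simp: nth_append less_Suc_eq)
  then show ?thesis
    unfolding reachable_def using w(2) ne by (intro exI[of _ "vs @ [b]"] exI[of _ "es @ [e]"]) auto
qed

lemma reachable_mono:
  assumes "reachable G u v" "verts G \<subseteq> verts H" "edges G \<subseteq> edges H"
    and "\<And>e. e \<in> edges G \<Longrightarrow> ends H e = ends G e"
  shows "reachable H u v"
proof -
  obtain vs es where w: "walk G vs es" "hd vs = u" "last vs = v"
    using assms(1) unfolding reachable_def by auto
  have "walk H vs es"
    using w(1) assms(2-) nth_mem unfolding walk_def by (metis order_trans subset_iff)
  then show ?thesis
    unfolding reachable_def using w by blast
qed

lemma reachable_verts: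
  assumes "reachable G u v"
  shows "u \<in> verts G" "v \<in> verts G"
proof -
  obtain vs es where w: "walk G vs es" "hd vs = u" "last vs = v"
    using assms unfolding reachable_def by auto
  then have "vs \<noteq> []" "set vs \<subseteq> verts G"
    unfolding walk_def by auto
  then show "u \<in> verts G" "v \<in> verts G"
    using w by auto
qed

text \<open>Turns connectivity into cut edges: at some step of the walk membership in
  \<open>A\<close> is lost.\<close>

lemma reachable_crossing_edge:
  assumes "reachable G u v" "u \<in> A" "v \<notin> A"
  obtains e a b where "e \<in> edges G" "ends G e = {a, b}" "a \<in> verts G" "b \<in> verts G" "a \<in> A" "b \<notin> A"
proof -
  obtain vs es where w: "walk G vs es" "hd vs = u" "last vs = v"
    using assms(1) unfolding reachable_def by auto
  have len: "length vs = Suc (length es)" and ne: "vs \<noteq> []" and sub: "set vs \<subseteq> verts G"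
    using w(1) unfolding walk_def by auto
  have 0: "vs ! 0 \<in> A" and l: "vs ! length es \<notin> A"
    using w assms ne len by (auto simp: hd_conv_nth last_conv_nth)
  have "\<exists>i<length es. vs ! i \<in> A \<and> vs ! Suc i \<notin> A"
  proof (rule ccontr)
    assume c: "\<not> ?thesis"
    have "i \<le> length es \<Longrightarrow> vs ! i \<in> A" for i
      using c 0 by (induction i) auto
    then show False using l by blast
  qed
  then obtain i where i: "i < length es" "vs ! i \<in> A" "vs ! Suc i \<notin> A"
    by blast
  show ?thesis
  proof (rule that[of "es ! i" "vs ! i" "vs ! Suc i"])
    show "es ! i \<in> edges G" "ends G (es ! i) = {vs ! i, vs ! Suc i}"
      using w(1) i unfolding walk_def by auto
    show "vs ! i \<in> verts G" "vs ! Suc i \<in> verts G"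
      using sub len i by (auto simp: subset_iff)
  qed (use i in auto)
qed

text \<open>Take the first vertex of a longest path: an edge there other than the first path edge
  would prolong the path or close a cycle. An isolated vertex also qualifies.\<close>

lemma forest_obtain_leaf:
  assumes "finite_mgraph G" "forest G" "verts G \<noteq> {}"
  obtains v where "v \<in> verts G" "\<And>e e'. \<lbrakk>e \<in> edges G; e' \<in> edges G; v \<in> ends G e; v \<in> ends G e'\<rbrakk> \<Longrightarrow> e = e'"
proof -
  define P where "P = (\<lambda>m. \<exists>vs es. walk G vs es \<and> distinct vs \<and> length vs = m)"
  obtain u where u: "u \<in> verts G" using assms(3) by auto
  have "P 1"
    unfolding P_def walk_def by (intro exI[of _ "[u]"] exI[of _ "[]"]) (use u in auto)
  moreover have bound: "m \<le> card (verts G)" if "P m" for m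
    using that assms(1) unfolding P_def walk_def finite_mgraph_def
    by (metis card_mono distinct_card)
  ultimately obtain m where m: "P m" "\<And>m'. P m' \<Longrightarrow> m' \<le> m"
    by (metis GreatestI_nat Greatest_le_nat)
  obtain vs es where w: "walk G vs es" and d: "distinct vs" and lm: "length vs = m"
    using m(1) unfolding P_def by auto
  have len: "length vs = Suc (length es)" and sub: "set vs \<subseteq> verts G"
    and ends: "\<And>i. i < length es \<Longrightarrow> ends G (es ! i) = {vs ! i, vs ! Suc i}"
    using w unfolding walk_def by auto
  define v where "v = vs ! 0"
  have v: "v \<in> set vs" using len v_def by auto
  have first: "es \<noteq> [] \<and> e = es ! 0" if e: "e \<in> edges G" "v \<in> ends G e" for e
  proof (rule ccontr)
    assume n0: "\<not> ?thesis"
    obtain a b where "ends G e = {a, b}" "a \<in> verts G" "b \<in> verts G"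
      using e(1) assms(1) unfolding finite_mgraph_def by blast
    then obtain w where w1: "ends G e = {w, v}" "w \<in> verts G"
      using e(2) that[of a] that[of b] by (auto simp: insert_commute)
    show False
    proof (cases "w \<in> set vs")
      case False
      have "walk G (w # vs) (e # es)"
        using w w1 e False v_def unfolding walk_def by (auto simp: nth_Cons split: nat.split)
      then have "P (Suc m)"
        unfolding P_def using False d lm by (intro exI[of _ "w # vs"] exI[of _ "e # es"]) auto
      then show False using m(2) by fastforce
    next
      case True
      then obtain j where j: "j < length vs" "w = vs ! j" by (metis in_set_conv_nth)
      have jl: "j \<le> length es" using j len by auto
      have neq: "e \<noteq> es ! i" if i: "i < j" for i
      proof
        assume eq: "e = es ! i"
        then have "v \<in> {vs ! i, vs ! Suc i}" using ends[of i] i jl e by auto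
        then have "i = 0"
          using d v_def len i jl by (auto simp: nth_eq_iff_index_eq)
        then show False using n0 eq i jl by auto
      qed
      have des: "es ! i \<noteq> es ! i'" if "i < i'" "i' < length es" for i i'
      proof
        assume "es ! i = es ! i'"
        then have "{vs ! i, vs ! Suc i} = {vs ! i', vs ! Suc i'}"
          using ends[of i] ends[of i'] that by auto
        then have "vs ! i = vs ! i' \<or> vs ! i = vs ! Suc i'" by auto
        then show False using d that len by (auto simp: nth_eq_iff_index_eq)
      qed
      have "distinct es"
        unfolding distinct_conv_nth using des by (metis linorder_neqE_nat)
      moreover have "e \<notin> set (take j es)"
        using neq by (auto simp: in_set_conv_nth)
      \<comment> \<open>The edge \<open>e\<close> from \<open>w = vs ! j\<close> to
        \<open>vs ! 0\<close>, followed by the path back to \<open>w\<close>; \<open>j = 0\<close>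
        gives a loop and \<open>j = 1\<close> a pair of parallel edges.\<close>
      moreover have "walk G (w # take (Suc j) vs) (e # take j es)"
        using w w1 e v_def len jl unfolding walk_def
        by (auto simp: nth_Cons min_def dest: in_set_takeD split: nat.split)
      moreover have "last (w # take (Suc j) vs) = w"
        using j by (simp add: take_Suc_conv_app_nth)
      ultimately have "cycle G (w # take (Suc j) vs) (e # take j es)"
        unfolding cycle_def using d by auto
      then show False using assms(2) unfolding forest_def by blast
    qed
  qed
  show ?thesis
    by (rule that[of v]) (use v sub first in auto)
qed

text \<open>Deleting a vertex that lies on at most one edge loses at most one edge, so induction on
  the number of vertices applies. Subtracting the number of components would be sharper, but this
  suffices for the edge count.\<close>

lemma card_edges_forest:
  assumes "finite_mgraph G" "forest G"
  shows "card (edges G) \<le> card (verts G)"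
  using assms
proof (induction "card (verts G)" arbitrary: G)
  case 0
  then have "verts G = {}" "edges G = {}" unfolding finite_mgraph_def by auto
  then show ?case by simp
next
  case (Suc m)
  then have fin: "finite (verts G)" "finite (edges G)" and ne: "verts G \<noteq> {}"
    unfolding finite_mgraph_def by auto
  obtain v where v: "v \<in> verts G" 
    and leaf: "\<And>e e'. \<lbrakk>e \<in> edges G; e' \<in> edges G; v \<in> ends G e; v \<in> ends G e'\<rbrakk> \<Longrightarrow> e = e'"
    using forest_obtain_leaf[OF Suc.prems ne] by blast
  define G' where "G' = induced G (verts G - {v})"
  have vG': "verts G' = verts G - {v}" by (simp add: G'_def induced_def)
  have eG': "edges G' = {e \<in> edges G. v \<notin> ends G e}"
    using Suc.prems(1) unfolding G'_def induced_def finite_mgraph_def by fastforce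
  have "finite_mgraph G'"
    unfolding finite_mgraph_def
  proof (intro conjI ballI)
    fix e assume e: "e \<in> edges G'"
    then obtain a b where "a \<in> verts G" "b \<in> verts G" "ends G e = {a, b}" "v \<notin> ends G e"
      using Suc.prems(1) eG' unfolding finite_mgraph_def by blast
    then show "\<exists>a\<in>verts G'. \<exists>b\<in>verts G'. ends G' e = {a, b}"
      using vG' unfolding G'_def induced_def by auto
  qed (use fin vG' eG' in auto)
  moreover have "forest G'"
  proof -
    have "cycle G vs es" if "cycle G' vs es" for vs es
      using that unfolding cycle_def walk_def G'_def induced_def by auto
    then show ?thesis using Suc.prems(2) unfolding forest_def by blast
  qed
  ultimately have "card (edges G') \<le> card (verts G')"
    using Suc.hyps(1)[of G'] Suc.hyps(2) v fin vG' by simp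
  moreover have "card (edges G) \<le> Suc (card (edges G'))"
  proof (cases "\<exists>e\<in>edges G. v \<in> ends G e")
    case True
    then obtain e where e: "e \<in> edges G" "v \<in> ends G e" by auto
    have "edges G = insert e (edges G')" using e leaf eG' by auto
    then have "card (edges G) = card (insert e (edges G'))" by simp
    also have "\<dots> = Suc (card (edges G'))" using eG' e fin by simp
    finally show ?thesis by simp
  next
    case False
    then have "edges G = edges G'" using eG' by auto
    then show ?thesis by simp
  qed
  ultimately show ?case using v fin vG' Suc.hyps(2) by simp
qed

lemma finite_mgraph_spanning_forest:
  assumes "finite_mgraph G" "spanning_forest T (induced G W)" "finite W"
  shows "finite_mgraph T"
proof -
  have s: "verts T = W" "edges T \<subseteq> edges G" "\<And>e. e \<in> edges T \<Longrightarrow> ends T e = ends G e \<and> ends T e \<subseteq> W"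
    using assms(2) unfolding spanning_forest_def subgraph_def induced_def by auto
  have "finite (edges T)"
    by (rule finite_subset[OF s(2)]) (use assms(1) in \<open>simp add: finite_mgraph_def\<close>)
  moreover have "\<exists>u\<in>W. \<exists>v\<in>W. ends T e = {u, v}" if "e \<in> edges T" for e
  proof -
    have "e \<in> edges G" using that s(2) by blast
    then obtain u v where "ends G e = {u, v}" using assms(1) unfolding finite_mgraph_def by blast
    then show ?thesis using s(3)[OF that] by (intro bexI[of _ u] bexI[of _ v]) auto
  qed
  ultimately show ?thesis unfolding finite_mgraph_def using s(1) assms(3) by simp
qed

text \<open>Each forest has at most as many edges as its sample has vertices, which leaves only the
  total sample size to be bounded.\<close>

lemma card_edges_union_subgraph:
  assumes "finite_mgraph G" "\<And>i. i \<in> {1..r} \<Longrightarrow> V i \<subseteq> verts G"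
    and "\<And>i. i \<in> {1..r} \<Longrightarrow> spanning_forest (T i) (induced G (V i))"
  shows "card (edges (union_subgraph G r T)) \<le> (\<Sum>i\<in>{1..r}. card (V i))"
proof -
  have "card (edges (union_subgraph G r T)) \<le> (\<Sum>i\<in>{1..r}. card (edges (T i)))"
    unfolding union_subgraph_def by (simp add: card_UN_le)
  also have "\<dots> \<le> (\<Sum>i\<in>{1..r}. card (V i))"
  proof (rule sum_mono)
    fix i assume i: "i \<in> {1..r}"
    have "finite (V i)"
      by (rule finite_subset[OF assms(2)[OF i]]) (use assms(1) in \<open>simp add: finite_mgraph_def\<close>)
    then have "finite_mgraph (T i)"
      by (rule finite_mgraph_spanning_forest[OF assms(1) assms(3)[OF i]])
    moreover have "forest (T i)" "verts (T i) = V i"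
      using assms(3)[OF i] unfolding spanning_forest_def induced_def by auto
    ultimately show "card (edges (T i)) \<le> card (V i)"
      using card_edges_forest by fastforce
  qed
  finally show ?thesis .
qed

subsection \<open>Vertex connectivity of the union of forests\<close>

text \<open>
  The set \<open>Y\<close> separates \<open>u\<close> from \<open>v\<close> once the edges between \<open>u\<close> and \<open>v\<close> themselves are
  ignored; \<open>A\<close> is the side of \<open>u\<close>.
\<close>

definition separates :: "('v, 'e) mgraph \<Rightarrow> 'v \<Rightarrow> 'v \<Rightarrow> 'v set \<Rightarrow> bool" where
  "separates G u v Y \<longleftrightarrow> Y \<subseteq> verts G - {u, v} \<and> (\<exists>A. u \<in> A \<and> v \<notin> A \<and>
     (\<forall>e\<in>edges G. \<forall>a b. ends G e = {a, b} \<and> a \<in> A - Y \<and> b \<notin> A \<union> Y \<longrightarrow> {a, b} = {u, v}))"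

lemma subgraph_union_subgraph:
  assumes "finite_mgraph G"
    and "\<And>i. i \<in> {1..r} \<Longrightarrow> spanning_forest (T i) (induced G (V i))"
  shows "subgraph (union_subgraph G r T) G"
proof -
  have "edges (T i) \<subseteq> edges G" if "i \<in> {1..r}" for i
    using assms(2)[OF that] unfolding spanning_forest_def subgraph_def induced_def by auto
  moreover have "ends G e \<subseteq> verts G" if "e \<in> edges G" for e
    using assms(1) that unfolding finite_mgraph_def by auto
  ultimately show ?thesis
    unfolding subgraph_def union_subgraph_def by fastforce
qed

text \<open>Deleting all vertices but one shows that the set under \<open>LEAST\<close> is
  nonempty.\<close>

lemma vertex_connectivity_attained:
  assumes "finite (verts G)" "verts G \<noteq> {}"
  obtains S where "S \<subseteq> verts G" "card S = vertex_connectivity G"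
    "\<not> connected_mgraph (induced G (verts G - S)) \<or> card (verts G - S) = 1"
proof -
  obtain v where v: "v \<in> verts G" using assms(2) by auto
  have "verts G - (verts G - {v}) = {v}" using v by auto
  then have "\<exists>m. \<exists>S\<subseteq>verts G. card S = m \<and>
     (\<not> connected_mgraph (induced G (verts G - S)) \<or> card (verts G - S) = 1)"
    by (intro exI[of _ "card (verts G - {v})"] exI[of _ "verts G - {v}"]) auto
  from LeastI_ex[OF this] show ?thesis
    unfolding vertex_connectivity_def[symmetric] using that by blast
qed

lemma vertex_connectivity_le:
  assumes "S \<subseteq> verts G" "\<not> connected_mgraph (induced G (verts G - S)) \<or> card (verts G - S) = 1"
  shows "vertex_connectivity G \<le> card S"
  unfolding vertex_connectivity_def by (rule Least_le) (use assms in blast)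

text \<open>A set attaining the minimum for \<open>G\<close> stays admissible for \<open>H\<close>,
  since having fewer edges can only destroy connections. This is the easy direction of the
  certificate.\<close>

lemma vertex_connectivity_subgraph_le:
  assumes "finite (verts G)" "verts G \<noteq> {}" "subgraph H G" "verts H = verts G"
  shows "vertex_connectivity H \<le> vertex_connectivity G"
proof -
  obtain S where S: "S \<subseteq> verts G" "card S = vertex_connectivity G"
    "\<not> connected_mgraph (induced G (verts G - S)) \<or> card (verts G - S) = 1"
    using vertex_connectivity_attained[OF assms(1,2)] by blast
  have "connected_mgraph (induced G (verts G - S))" if "connected_mgraph (induced H (verts G - S))"
  proof -
    have "reachable (induced G (verts G - S)) u v" if "reachable (induced H (verts G - S)) u v" for u v
      by (rule reachable_mono[OF that])
        (use assms(3) in \<open>auto simp: induced_def subgraph_def\<close>)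
    then show ?thesis using that unfolding connected_mgraph_def by (simp add: induced_def)
  qed
  then show ?thesis
    using vertex_connectivity_le[of S H] S assms(4) by auto
qed

text \<open>The deterministic core, with \<open>few_bad\<close> and \<open>low\<close> as the two
  properties of the samples. In \<open>low\<close> the separator \<open>Y'\<close> may differ from
  \<open>Y\<close>, so the samples only have to handle one fixed separator per pair.\<close>

lemma k_vertex_connected_union_subgraph:
  assumes G: "finite_mgraph G" "verts G \<noteq> {}" and k: "k \<ge> 1" "k_vertex_connected k G"
    and T: "\<And>i. i \<in> {1..r} \<Longrightarrow> spanning_forest (T i) (induced G (V i))"
    and few_bad: "\<And>X S. \<lbrakk>X \<subseteq> verts G; card X < k; card S = k; 
        \<And>e. e \<in> S \<Longrightarrow> e \<subseteq> verts G - X \<and> card e = 2\<rbrakk>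
      \<Longrightarrow> \<exists>i\<in>{1..r}. \<exists>e\<in>S. e \<subseteq> V i \<and> V i \<inter> X = {}"
    and low: "\<And>u v Y. \<lbrakk>u \<in> verts G; v \<in> verts G; u \<noteq> v; separates G u v Y; card Y \<le> 2 * (k - 1)\<rbrakk>
      \<Longrightarrow> \<exists>Y'. separates G u v Y' \<and> (\<exists>i\<in>{1..r}. {u, v} \<subseteq> V i \<and> V i \<inter> Y' = {})"
  shows "k_vertex_connected k (union_subgraph G r T)"
proof (rule ccontr)
  define H where "H = union_subgraph G r T"
  have H: "verts H = verts G" "ends H = ends G" "edges H = (\<Union>i\<in>{1..r}. edges (T i))"
    unfolding H_def union_subgraph_def by auto
  have Ti: "verts (T i) = V i" "\<And>e. e \<in> edges (T i) \<Longrightarrow> e \<in> edges G \<and> ends (T i) e = ends G e \<and> ends G e \<subseteq> V i"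
    "\<And>u v. reachable (induced G (V i)) u v \<Longrightarrow> reachable (T i) u v" if "i \<in> {1..r}" for i
    using T[OF that] unfolding spanning_forest_def subgraph_def induced_def by auto
  have finV: "finite (verts G)" using G unfolding finite_mgraph_def by auto
  have ends_sub: "ends G e \<subseteq> verts G" if "e \<in> edges G" for e
    using G(1) that unfolding finite_mgraph_def by auto
  assume "\<not> k_vertex_connected k (union_subgraph G r T)"
  then have less: "vertex_connectivity H < k" unfolding k_vertex_connected_def H_def by simp
  obtain X where X: "X \<subseteq> verts G" "card X < k"
    "\<not> connected_mgraph (induced H (verts G - X)) \<or> card (verts G - X) = 1"
    using vertex_connectivity_attained[of H] finV G(2) H(1) less by metis
  have GX: "connected_mgraph (induced G (verts G - X))" "card (verts G - X) \<noteq> 1"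
    using vertex_connectivity_le[of X G] X k(2) unfolding k_vertex_connected_def by auto
  define HX where "HX = induced H (verts G - X)"
  have HX: "verts HX = verts G - X" "ends HX = ends G"
    "edges HX = {e \<in> edges H. ends G e \<subseteq> verts G - X}"
    unfolding HX_def induced_def using H by auto
  obtain s t where st: "s \<in> verts G - X" "t \<in> verts G - X" "\<not> reachable HX s t"
    using X(3) GX(2) unfolding connected_mgraph_def HX_def[symmetric] HX(1) by auto
  \<comment> \<open>\<open>A\<close> is the component of \<open>s\<close> in
    \<open>H - X\<close>.\<close>
  define A where "A = {w. reachable HX s w}"
  have sA: "s \<in> A" "t \<notin> A"
    using reachable_refl[of s HX] st HX(1) by (auto simp: A_def)
  have Asub: "A \<subseteq> verts G - X" using reachable_verts HX(1) unfolding A_def by fastforce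
  \<comment> \<open>Collecting pairs of ends rather than edges makes parallel edges count
    once.\<close>
  define D where "D = {{a, b} |a b. a \<in> A \<and> b \<in> verts G - X - A \<and> (\<exists>e\<in>edges G. ends G e = {a, b})}"
  have D2: "d \<subseteq> verts G - X \<and> card d = 2" if d: "d \<in> D" for d
  proof -
    obtain a b where "d = {a, b}" "a \<in> A" "b \<in> verts G - X - A" using d unfolding D_def by blast
    then show ?thesis using Asub by (auto simp: card_2_iff)
  qed
  have finD: "finite D"
    by (rule finite_subset[of _ "Pow (verts G)"]) (use D2 finV in auto)
  txt \<open>No sample avoiding \<open>X\<close> contains both ends of an edge leaving \<open>A\<close>, so there are few such pairs of ends.\<close>
  have Dk: "card D < k"
  proof (rule ccontr)
    assume "\<not> card D < k"
    then obtain S where S: "S \<subseteq> D" "card S = k"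
      by (metis obtain_subset_with_card_n not_less)
    then have "\<exists>i\<in>{1..r}. \<exists>e\<in>S. e \<subseteq> V i \<and> V i \<inter> X = {}"
      using few_bad[of X S] X D2 by blast
    then obtain i d where i: "i \<in> {1..r}" "d \<in> S" "d \<subseteq> V i" "V i \<inter> X = {}" by blast
    then obtain a b e where ab: "d = {a, b}" "a \<in> A" "b \<in> verts G - X - A" "e \<in> edges G" "ends G e = {a, b}"
      using S(1) unfolding D_def by blast
    have "reachable (induced G (V i)) a a"
      by (rule reachable_refl) (use i ab in \<open>auto simp: induced_def\<close>)
    then have "reachable (induced G (V i)) a b"
      by (rule reachable_step[of _ _ _ e]) (use i ab in \<open>auto simp: induced_def\<close>)
    then have "reachable (T i) a b" using Ti(3) i by blast
    \<comment> \<open>The forest path from \<open>a\<close> to \<open>b\<close> must leave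
      \<open>A\<close>; as the sample avoids \<open>X\<close>, the edge used there lies in
      \<open>HX\<close> and would enlarge \<open>A\<close>.\<close>
    then obtain e' c c' where e': "e' \<in> edges (T i)" "ends (T i) e' = {c, c'}" "c \<in> A" "c' \<notin> A"
      by (rule reachable_crossing_edge[where A = A]) (use ab in auto)
    have g: "e' \<in> edges G" "ends G e' = {c, c'}" "c \<in> V i" "c' \<in> V i"
      using Ti(2)[OF i(1) e'(1)] e'(2) by auto
    have sub: "{c, c'} \<subseteq> verts G - X"
      using ends_sub[OF g(1)] g i by blast
    have "reachable HX s c'"
      by (rule reachable_step[of _ _ c e'])
        (use g sub e' i HX H in \<open>auto simp: A_def\<close>)
    then show False using e' A_def by auto
  qed
  have "reachable (induced G (verts G - X)) s t"
    using GX(1) st unfolding connected_mgraph_def by (auto simp: induced_def)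
  then obtain e u v where e: "e \<in> edges G" "ends G e = {u, v}" "u \<in> verts G - X" "v \<in> verts G - X"
    "u \<in> A" "v \<notin> A"
    by (rule reachable_crossing_edge[where A = A]) (use sA in \<open>auto simp: induced_def\<close>)
  have uvD: "{u, v} \<in> D" unfolding D_def using e by blast
  have uv: "u \<noteq> v" using e by auto
  define f where "f = (\<lambda>d. SOME x. x \<in> d - {u, v})"
  have f: "f d \<in> d - {u, v}" if d: "d \<in> D - {{u, v}}" for d
  proof -
    have "\<not> d \<subseteq> {u, v}"
      using D2[of d] d uv card_seteq[of "{u, v}" d] by auto
    then have "\<exists>x. x \<in> d - {u, v}" by blast
    then show ?thesis unfolding f_def by (rule someI_ex)
  qed
  txt \<open>Hitting every other pair away from \<open>u\<close> and \<open>v\<close> leaves only \<open>u v\<close> edges across the cut.\<close>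
  define Y where "Y = X \<union> f ` (D - {{u, v}})"
  have "card (f ` (D - {{u, v}})) \<le> card D - 1"
    using card_image_le[of "D - {{u, v}}" f] finD uvD by simp
  \<comment> \<open>At most \<open>k - 1\<close> vertices come from \<open>X\<close> and at most
    \<open>card D - 1\<close>, hence at most \<open>k - 2\<close>, from the other pairs.\<close>
  then have cardY: "card Y \<le> 2 * (k - 1)"
    using card_Un_le[of X "f ` (D - {{u, v}})"] Dk X(2) unfolding Y_def by linarith
  have Ysub: "Y \<subseteq> verts G - {u, v}"
    using f D2 X(1) e unfolding Y_def by blast
  have "separates G u v Y"
    unfolding separates_def
  proof (intro conjI exI[of _ A] ballI allI impI)
    fix e' a b assume e': "e' \<in> edges G" "ends G e' = {a, b} \<and> a \<in> A - Y \<and> b \<notin> A \<union> Y"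
    show "{a, b} = {u, v}"
    proof (rule ccontr)
      assume ne: "{a, b} \<noteq> {u, v}"
      have "b \<in> verts G - X" using e' ends_sub[OF e'(1)] unfolding Y_def by auto
      then have "{a, b} \<in> D" unfolding D_def using e' by blast
      then have "f {a, b} \<in> {a, b} \<inter> Y" using f[of "{a, b}"] ne unfolding Y_def by blast
      then show False using e'(2) by auto
    qed
  qed (use Ysub e in auto)
  \<comment> \<open>\<open>Y'\<close> need not be \<open>Y\<close>, so its own side \<open>B\<close>
    replaces \<open>A\<close> as the cut to be crossed.\<close>
  then obtain Y' i where Y': "separates G u v Y'" and i: "i \<in> {1..r}" "{u, v} \<subseteq> V i" "V i \<inter> Y' = {}"
    using low[of u v Y] e uv cardY by auto
  obtain B where B: "u \<in> B" "v \<notin> B"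
    and B_uv: "\<forall>e\<in>edges G. \<forall>a b. ends G e = {a, b} \<and> a \<in> B - Y' \<and> b \<notin> B \<union> Y' \<longrightarrow> {a, b} = {u, v}"
    using Y' unfolding separates_def by (elim conjE exE)
  have "reachable (induced G (V i)) u u"
    by (rule reachable_refl) (use i in \<open>auto simp: induced_def\<close>)
  then have "reachable (induced G (V i)) u v"
    by (rule reachable_step[of _ _ _ e]) (use i e in \<open>auto simp: induced_def\<close>)
  then have "reachable (T i) u v" using Ti(3) i by blast
  \<comment> \<open>The forest path from \<open>u\<close> to \<open>v\<close> leaves
    \<open>B\<close> while avoiding \<open>Y'\<close>, so the edge used there must have ends
    \<open>{u, v}\<close>.\<close>
  then obtain e' a b where e': "e' \<in> edges (T i)" "ends (T i) e' = {a, b}" "a \<in> B" "b \<notin> B"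
    by (rule reachable_crossing_edge[where A = B]) (use B in auto)
  have g: "e' \<in> edges G" "ends G e' = {a, b}" "a \<in> V i" "b \<in> V i"
    using Ti(2)[OF i(1) e'(1)] e'(2) by auto
  have "{a, b} = {u, v}"
    by (rule B_uv[rule_format, OF g(1)]) (use e' g i in auto)
  then have "ends G e' = {u, v}" using g by simp
  then have "e' \<in> edges HX" "ends HX e' = {u, v}"
    using HX H e(3,4) e'(1) i(1) by auto
  then have "reachable HX s v"
    by (rule reachable_step[rotated]) (use e(4,5) HX A_def in auto)
  then show False using e(6) A_def by auto
qed

subsection \<open>Random subsets\<close>

text \<open>Vertices are included independently: those of \<open>A\<close> contribute
  \<open>p\<close>, those of \<open>X\<close> contribute \<open>1 - p\<close>, and all others
  1.\<close>

lemma prob_random_subset_contains_avoids: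
  assumes "finite W" "0 \<le> p" "p \<le> 1" "A \<subseteq> W" "X \<subseteq> W" "A \<inter> X = {}"
  shows "measure_pmf.prob (random_subset W p) {U. A \<subseteq> U \<and> U \<inter> X = {}} = p ^ card A * (1 - p) ^ card X"
proof -
  define B where "B = (\<lambda>x. if x \<in> A then {True} else if x \<in> X then {False} else UNIV)"
  have "(\<lambda>b. {v \<in> W. b v}) -` {U. A \<subseteq> U \<and> U \<inter> X = {}} = Pi W B"
    using assms(4-6) by (fastforce simp: B_def Pi_def split: if_splits)
  then have "measure_pmf.prob (random_subset W p) {U. A \<subseteq> U \<and> U \<inter> X = {}} =
      (\<Prod>x\<in>W. measure_pmf.prob (bernoulli_pmf p) (B x))"
    using assms(1) by (simp add: random_subset_def measure_Pi_pmf_Pi)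
  also have "\<dots> = (\<Prod>x\<in>W. (if x \<in> A then p else 1) * (if x \<in> X then 1 - p else 1))"
    using assms by (intro prod.cong) (auto simp: B_def measure_pmf_single)
  also have "\<dots> = (\<Prod>x\<in>W. if x \<in> A then p else 1) * (\<Prod>x\<in>W. if x \<in> X then 1 - p else 1)"
    by (rule prod.distrib)
  also have "(\<Prod>x\<in>W. if x \<in> A then p else 1) = (\<Prod>x\<in>A. p)"
    using assms by (simp add: prod.If_cases Int_absorb1)
  also have "(\<Prod>x\<in>W. if x \<in> X then 1 - p else 1) = (\<Prod>x\<in>X. 1 - p)"
    using assms by (simp add: prod.If_cases Int_absorb1)
  finally show ?thesis by simp
qed

text \<open>Bonferroni: two distinct pairs have at least three vertices in their union.\<close>

lemma prob_random_subset_contains_pair_ge: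
  assumes "finite W" "0 \<le> p" "p \<le> 1" "X \<subseteq> W" "finite S"
    and "\<And>e. e \<in> S \<Longrightarrow> e \<subseteq> W - X \<and> card e = 2"
  shows "measure_pmf.prob (random_subset W p) {U. (\<exists>e\<in>S. e \<subseteq> U) \<and> U \<inter> X = {}} \<ge>
    (1 - p) ^ card X * (real (card S) * p ^ 2 - real (card S) * (real (card S) - 1) / 2 * p ^ 3)"
  using assms(5,6)
proof (induction S rule: finite_induct)
  case empty
  then show ?case by simp
next
  case (insert e S)
  let ?P = "measure_pmf.prob (random_subset W p)"
  let ?q = "(1 - p) ^ card X"
  define E where "E = {U. (\<exists>e\<in>S. e \<subseteq> U) \<and> U \<inter> X = {}}"
  define F where "F = (\<lambda>A. {U. A \<subseteq> U \<and> U \<inter> X = {}})"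
  have F: "?P (F A) = p ^ card A * ?q" if "A \<subseteq> W - X" for A
    unfolding F_def using that assms by (intro prob_random_subset_contains_avoids) auto
  have e: "e \<subseteq> W - X" "card e = 2" using insert.prems by auto
  have "?P (E \<inter> F e) \<le> ?P (\<Union>d\<in>S. F (d \<union> e))"
    by (rule measure_pmf.finite_measure_mono) (auto simp: E_def F_def)
  also have "\<dots> \<le> (\<Sum>d\<in>S. ?P (F (d \<union> e)))"
    by (rule measure_pmf.finite_measure_subadditive_finite) (use insert in auto)
  also have "\<dots> \<le> (\<Sum>d\<in>S. p ^ 3 * ?q)"
  proof (rule sum_mono)
    fix d assume d: "d \<in> S"
    then have d': "d \<subseteq> W - X" "card d = 2" "d \<noteq> e" using insert by auto
    have fin: "finite (d \<union> e)" using d' e assms(1) by (meson Un_least finite_Diff finite_subset)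
    have "card (d \<union> e) \<ge> 3"
    proof (rule ccontr)
      assume "\<not> 3 \<le> card (d \<union> e)"
      then have "d = d \<union> e" "e = d \<union> e"
        using d'(2) e(2) fin by (intro card_seteq; simp)+
      then show False using d' by simp
    qed
    then have "p ^ card (d \<union> e) \<le> p ^ 3"
      using assms by (intro power_decreasing) auto
    then show "?P (F (d \<union> e)) \<le> p ^ 3 * ?q"
      using F[of "d \<union> e"] d' e assms by (simp add: mult_right_mono)
  qed
  finally have inter: "?P (E \<inter> F e) \<le> real (card S) * (p ^ 3 * ?q)" by simp
  have event: "{U. (\<exists>d\<in>insert e S. d \<subseteq> U) \<and> U \<inter> X = {}} = E \<union> F e"
    unfolding E_def F_def by auto
  have union: "?P (E \<union> F e) = ?P E + ?P (F e) - ?P (E \<inter> F e)"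
    using measure_pmf.finite_measure_Union'[of E "random_subset W p" "F e"]
      measure_pmf.finite_measure_Diff'[of "F e" "random_subset W p" E]
    by (simp add: Int_commute)
  have IH: "?q * (real (card S) * p ^ 2 - real (card S) * (real (card S) - 1) / 2 * p ^ 3) \<le> ?P E"
    unfolding E_def by (rule insert.IH) (use insert.prems in auto)
  \<comment> \<open>The new pair adds \<open>p ^ 2\<close> and at most \<open>card S\<close>
    overlaps, and \<open>card S\<close> is the increment of
    \<open>card S * (card S - 1) / 2\<close>.\<close>
  have "?q * (real (card (insert e S)) * p ^ 2
        - real (card (insert e S)) * (real (card (insert e S)) - 1) / 2 * p ^ 3)
      = ?q * (real (card S) * p ^ 2 - real (card S) * (real (card S) - 1) / 2 * p ^ 3)
        + p ^ 2 * ?q - real (card S) * (p ^ 3 * ?q)"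
    using insert.hyps by (simp add: field_simps power2_eq_square power3_eq_cube)
  also have "\<dots> \<le> ?P E + ?P (F e) - ?P (E \<inter> F e)"
    using F[OF e(1)] e(2) by (intro diff_mono add_mono IH inter) simp
  finally show ?case unfolding event union .
qed

text \<open>The samples are independent, and \<open>1 - a\<close> is at most
  \<open>exp (- a)\<close>.\<close>

lemma prob_random_subsets_all_miss_le:
  assumes "a \<le> measure_pmf.prob (random_subset W p) E"
  shows "measure_pmf.prob (random_subsets r W p) {V. \<forall>i\<in>{1..r}. V i \<notin> E} \<le> exp (- (a * real r))"
proof -
  have "{V. \<forall>i\<in>{1..r}. V i \<notin> E} = Pi {1..r} (\<lambda>_. - E)" by auto
  then have "measure_pmf.prob (random_subsets r W p) {V. \<forall>i\<in>{1..r}. V i \<notin> E} =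
      measure_pmf.prob (random_subset W p) (- E) ^ r"
    by (simp add: random_subsets_def measure_Pi_pmf_Pi)
  also have "\<dots> \<le> exp (- a) ^ r"
  proof (rule power_mono)
    have "measure_pmf.prob (random_subset W p) (- E) = 1 - measure_pmf.prob (random_subset W p) E"
      using measure_pmf.prob_compl[of E "random_subset W p"] by (simp add: Compl_eq_Diff_UNIV)
    then show "measure_pmf.prob (random_subset W p) (- E) \<le> exp (- a)"
      using assms exp_ge_add_one_self[of "- a"] by linarith
  qed simp
  also have "\<dots> = exp (- (a * real r))"
    by (simp add: exp_of_nat_mult[symmetric] mult.commute)
  finally show ?thesis .
qed

section \<open>Support and upper tail of the sample sizes\<close>

lemma set_pmf_random_subset: "finite W \<Longrightarrow> set_pmf (random_subset W p) \<subseteq> Pow W"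
  by (auto simp: random_subset_def)

lemma set_pmf_random_subsets:
  assumes "finite W" "V \<in> set_pmf (random_subsets r W p)" "i \<in> {1..r}"
  shows "V i \<subseteq> W"
proof -
  have "V i \<in> set_pmf (random_subset W p)"
    using assms unfolding random_subsets_def by (auto simp: set_Pi_pmf PiE_dflt_def)
  then show ?thesis using set_pmf_random_subset assms(1) by blast
qed

lemma finite_set_pmf_random_subset: "finite W \<Longrightarrow> finite (set_pmf (random_subset W p))"
  by (rule finite_subset[OF set_pmf_random_subset]) auto

text \<open>\<open>2 ^ card U\<close> is a product over the vertices of independent factors, each of
  mean \<open>1 + p\<close>.\<close>

lemma expectation_two_power_card_random_subset:
  assumes "finite W" "0 \<le> p" "p \<le> 1"
  shows "measure_pmf.expectation (random_subset W p) (\<lambda>U. (2::real) ^ card U) = (1 + p) ^ card W"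
proof -
  have "(2::real) ^ card {v \<in> W. b v} = (\<Prod>v\<in>W. if b v then 2 else 1)" for b
    using assms(1) by (simp add: prod.If_cases Int_def)
  then have "measure_pmf.expectation (random_subset W p) (\<lambda>U. (2::real) ^ card U) =
      measure_pmf.expectation (Pi_pmf W False (\<lambda>_. bernoulli_pmf p)) (\<lambda>b. \<Prod>v\<in>W. if b v then 2 else 1)"
    unfolding random_subset_def by simp
  also have "\<dots> = (\<Prod>v\<in>W. measure_pmf.expectation (bernoulli_pmf p) (\<lambda>b. if b then 2 else 1))"
    using assms(1)
    by (intro expectation_prod_Pi_pmf) (auto intro: integrable_measure_pmf_finite)
  also have "\<dots> = (1 + p) ^ card W"
    using assms by (simp add: algebra_simps)
  finally show ?thesis .
qed

lemma prob_sum_card_random_subsets_ge: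
  assumes "finite W" "0 \<le> p" "p \<le> 1"
  shows "measure_pmf.prob (random_subsets r W p)
      {V. 3 * (real (card W) * p * real r) \<le> real (\<Sum>i\<in>{1..r}. card (V i))}
    \<le> exp (- (real (card W) * p * real r))"
proof -
  let ?M = "random_subsets r W p"
  define m where "m = real (card W) * p * real r"
  define f where "f = (\<lambda>V. \<Prod>i\<in>{1..r}. (2::real) ^ card (V i :: 'a set))"
  have f: "f V = 2 powr real (\<Sum>i\<in>{1..r}. card (V i))" for V
    unfolding f_def by (simp add: powr_realpow power_sum del: of_nat_sum)
  have int: "integrable (measure_pmf (random_subset W p)) (\<lambda>U. (2::real) ^ card U)"
    by (intro integrable_measure_pmf_finite finite_set_pmf_random_subset assms)
  have "finite (set_pmf ?M)"
    unfolding random_subsets_def using finite_set_pmf_random_subset[OF assms(1)]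
    by (simp add: set_Pi_pmf finite_PiE_dflt)
  then have intf: "integrable (measure_pmf ?M) f"
    by (rule integrable_measure_pmf_finite)
  have "measure_pmf.expectation ?M f = (1 + p) ^ (card W * r)"
    unfolding f_def random_subsets_def using int assms
    by (subst expectation_prod_Pi_pmf) (auto simp: expectation_two_power_card_random_subset power_mult)
  also have "\<dots> \<le> exp p ^ (card W * r)"
    using assms by (intro power_mono) auto
  also have "\<dots> = exp m"
    by (simp add: exp_of_nat_mult[symmetric] m_def mult_ac)
  finally have E: "measure_pmf.expectation ?M f \<le> exp m" .
  have "measure_pmf.prob ?M {V. 3 * m \<le> real (\<Sum>i\<in>{1..r}. card (V i))} =
      measure_pmf.prob ?M {V \<in> space (measure_pmf ?M). 2 powr (3 * m) \<le> f V}"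
    unfolding f by simp
  also have "\<dots> \<le> measure_pmf.expectation ?M f / 2 powr (3 * m)"
    by (rule integral_Markov_inequality_measure[OF intf, where A = "{}"]) (simp_all add: f_def prod_nonneg)
  also have "\<dots> \<le> exp m / 2 powr (3 * m)"
    using E by (simp add: divide_right_mono)
  also have "\<dots> = exp (m - 3 * m * ln 2)"
    by (simp add: powr_def exp_diff)
  \<comment> \<open>The factor 3 makes \<open>2 powr (3 * m)\<close> at least
    \<open>exp (2 * m)\<close>, because \<open>ln 2\<close> is at least 2/3.\<close>
  also have "\<dots> \<le> exp (- m)"
  proof -
    have "m * (2 / 3) \<le> m * ln 2"
      using ln2_ge_two_thirds assms by (intro mult_left_mono) (auto simp: m_def)
    then show ?thesis by simp
  qed
  finally show ?thesis unfolding m_def .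
qed

text \<open>\<open>1 - 1 / k\<close> is the reciprocal of \<open>1 + 1 / (k - 1)\<close>, whose
  power \<open>k - 1\<close> is at most \<open>exp 1\<close>, hence at most 3. For
  \<open>k = 1\<close> the exponent is 0.\<close>

lemma one_minus_inverse_power_ge:
  assumes "k \<ge> 1" "j \<le> k - 1"
  shows "(1 - 1 / real k) ^ j \<ge> 1 / 3"
proof (cases "k = 1")
  case False
  define m where "m = k - 1"
  have m: "m \<ge> 1" "real k = real m + 1" using False assms by (auto simp: m_def)
  have "exp (1::real) \<ge> (1 + 1 / real m) ^ m"
  proof -
    have "(1 + 1 / real m) ^ m \<le> exp (1 / real m) ^ m"
      by (intro power_mono) auto
    then show ?thesis using m by (simp add: exp_of_nat_mult[symmetric])
  qed
  then have 3: "(1 + 1 / real m) ^ m \<le> 3" using exp_le by linarith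
  have "1 - 1 / real k = 1 / (1 + 1 / real m)" using m by (simp add: field_simps)
  then have "(1 - 1 / real k) ^ m = 1 / (1 + 1 / real m) ^ m" by (simp add: power_one_over)
  also have "\<dots> \<ge> 1 / 3"
    using 3 by (intro divide_left_mono) (auto intro!: mult_pos_pos zero_less_power add_pos_nonneg)
  finally have "(1 - 1 / real k) ^ m \<ge> 1 / 3" .
  moreover have "(1 - 1 / real k) ^ m \<le> (1 - 1 / real k) ^ j"
    using assms m_def by (intro power_decreasing) auto
  ultimately show ?thesis by linarith
qed (use assms in auto)

text \<open>The square of the previous bound; \<open>2 * (k - 1)\<close> is the largest size of a
  separator considered.\<close>

lemma one_minus_inverse_power_double_ge:
  assumes "k \<ge> 1" "j \<le> 2 * (k - 1)"
  shows "(1 - 1 / real k) ^ j \<ge> 1 / 9"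
proof -
  have "(1 / 3) ^ 2 \<le> ((1 - 1 / real k) ^ (k - 1)) ^ 2"
    using one_minus_inverse_power_ge[of k "k - 1"] assms by (intro power_mono) auto
  also have "\<dots> = (1 - 1 / real k) ^ (2 * (k - 1))" by (simp add: power_mult[symmetric] mult.commute)
  also have "\<dots> \<le> (1 - 1 / real k) ^ j"
    using assms by (intro power_decreasing) auto
  finally show ?thesis by (simp add: power2_eq_square)
qed

section \<open>Counting and union bounds\<close>

lemma card_subsets_le_power:
  assumes "finite A"
  shows "card {B. B \<subseteq> A \<and> card B = k} \<le> card A ^ k"
proof (cases "k \<le> card A")
  case True
  then show ?thesis using n_subsets[OF assms] binomial_le_pow by simp
next
  case False
  then show ?thesis using n_subsets[OF assms, of k] by (simp add: binomial_eq_0)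
qed

text \<open>In the induction the sizes below \<open>k\<close> and the size \<open>k\<close>
  contribute at most \<open>card A ^ k\<close> each; the factor \<open>card A \<ge> 2\<close>
  absorbs the doubling.\<close>

lemma card_small_subsets_le_power:
  assumes "finite A" "card A \<ge> 2"
  shows "card {B. B \<subseteq> A \<and> card B < k} \<le> card A ^ k"
proof (induction k)
  case (Suc k)
  have "{B. B \<subseteq> A \<and> card B < Suc k} = {B. B \<subseteq> A \<and> card B < k} \<union> {B. B \<subseteq> A \<and> card B = k}"
    by auto
  then have "card {B. B \<subseteq> A \<and> card B < Suc k} \<le> card A ^ k + card A ^ k"
    using card_Un_le[of "{B. B \<subseteq> A \<and> card B < k}" "{B. B \<subseteq> A \<and> card B = k}"]
      Suc card_subsets_le_power[OF assms(1), of k] by presburger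
  also have "\<dots> \<le> card A * card A ^ k"
    using mult_le_mono1[OF assms(2), of "card A ^ k"] by (simp only: mult_2)
  finally show ?case by simp
qed simp

lemma prob_UN_le_card_mult:
  assumes "finite I" "\<And>i. i \<in> I \<Longrightarrow> measure_pmf.prob M (E i) \<le> b"
  shows "measure_pmf.prob M (\<Union>i\<in>I. E i) \<le> real (card I) * b"
proof -
  have "measure_pmf.prob M (\<Union>i\<in>I. E i) \<le> (\<Sum>i\<in>I. measure_pmf.prob M (E i))"
    by (rule measure_pmf.finite_measure_subadditive_finite) (use assms in auto)
  also have "\<dots> \<le> real (card I) * b"
    using assms(2) by (rule sum_bounded_above)
  finally show ?thesis .
qed

text \<open>Union bound over \<open>n ^ k\<close> sets \<open>X\<close> and
  \<open>n ^ (2 * k)\<close> choices of \<open>k\<close> among at most \<open>n ^ 2\<close> pairs of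
  vertices.\<close>

lemma prob_k_pairs_all_missed_le:
  assumes "finite W" "n = card W" "n \<ge> 2" "k \<ge> 1" "real r \<ge> 200 * real k ^ 2 * ln (real n)"
  shows "measure_pmf.prob (random_subsets r W (1 / real k))
      {V. \<exists>X S. X \<subseteq> W \<and> card X < k \<and> card S = k \<and> (\<forall>e\<in>S. e \<subseteq> W - X \<and> card e = 2) \<and>
         (\<forall>i\<in>{1..r}. \<forall>e\<in>S. \<not> (e \<subseteq> V i \<and> V i \<inter> X = {}))}
    \<le> 1 / real n ^ 3"
proof -
  let ?M = "random_subsets r W (1 / real k)"
  define I where "I = {(X, S). X \<subseteq> W \<and> card X < k \<and> card S = k \<and> (\<forall>e\<in>S. e \<subseteq> W - X \<and> card e = 2)}"
  define miss where "miss = (\<lambda>(X, S). {V :: nat \<Rightarrow> 'a set.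
      \<forall>i\<in>{1..r}. \<forall>e\<in>S. \<not> (e \<subseteq> V i \<and> V i \<inter> X = {})})"
  define L where "L = ln (real n)"
  have L: "L \<ge> 0" "real n = exp L" using assms(3) by (auto simp: L_def)
  define Q where "Q = {e. e \<subseteq> W \<and> card e = 2}"
  have Q: "finite Q" "card Q \<le> n ^ 2"
    using assms(1,2) card_subsets_le_power[of W 2] by (auto simp: Q_def)
  have fin: "finite ({X. X \<subseteq> W \<and> card X < k} \<times> {S. S \<subseteq> Q \<and> card S = k})"
    using assms(1) Q by auto
  have Isub: "I \<subseteq> {X. X \<subseteq> W \<and> card X < k} \<times> {S. S \<subseteq> Q \<and> card S = k}"
    unfolding I_def Q_def by auto
  have "card I \<le> card {X. X \<subseteq> W \<and> card X < k} * card {S. S \<subseteq> Q \<and> card S = k}"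
    using card_mono[OF fin Isub] by (simp add: card_cartesian_product)
  also have "\<dots> \<le> n ^ k * (n ^ 2) ^ k"
  proof (rule mult_mono)
    show "card {X. X \<subseteq> W \<and> card X < k} \<le> n ^ k"
      using card_small_subsets_le_power[of W k] assms by simp
    show "card {S. S \<subseteq> Q \<and> card S = k} \<le> (n ^ 2) ^ k"
      using card_subsets_le_power[OF Q(1), of k] power_mono[OF Q(2), of k] by simp
  qed auto
  also have "\<dots> = n ^ (3 * k)"
    by (simp add: power_mult[symmetric] power_add[symmetric])
  finally have "card I \<le> n ^ (3 * k)" .
  then have cardI: "real (card I) \<le> real n ^ (3 * k)"
    by (metis of_nat_le_iff of_nat_power)
  have "measure_pmf.prob ?M (miss x) \<le> exp (- (1 / (6 * real k) * real r))" if "x \<in> I" for x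
  proof -
    obtain X S where "x = (X, S)" by (cases x)
    with that have x: "x = (X, S)" "X \<subseteq> W" "card X < k" "card S = k"
      "\<And>e. e \<in> S \<Longrightarrow> e \<subseteq> W - X \<and> card e = 2"
      unfolding I_def by auto
    \<comment> \<open>An infinite \<open>S\<close> would have \<open>card S = 0\<close>, whereas
      \<open>k\<close> is at least 1.\<close>
    have "finite S" using x(4) assms(4) by (metis card.infinite not_one_le_zero)
    have k: "real k \<ge> 1" using assms(4) by simp
    have "1 / (6 * real k) = 1 / 3 * (1 / (2 * real k))" by simp
    also have "\<dots> \<le> (1 - 1 / real k) ^ card X *
        (real k * (1 / real k) ^ 2 - real k * (real k - 1) / 2 * (1 / real k) ^ 3)"
    proof (rule mult_mono)
      show "1 / 3 \<le> (1 - 1 / real k) ^ card X"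
        using one_minus_inverse_power_ge[of k "card X"] assms(4) x(3) by simp
      \<comment> \<open>The right side equals \<open>(k + 1) / (2 * k ^ 2)\<close>.\<close>
      show "1 / (2 * real k) \<le> real k * (1 / real k) ^ 2 - real k * (real k - 1) / 2 * (1 / real k) ^ 3"
        using k by (simp add: field_simps power2_eq_square power3_eq_cube)
    qed (use k in auto)
    also have "\<dots> \<le> measure_pmf.prob (random_subset W (1 / real k)) {U. (\<exists>e\<in>S. e \<subseteq> U) \<and> U \<inter> X = {}}"
      using prob_random_subset_contains_pair_ge[of W "1 / real k" X S] assms(1) x(2,4,5) \<open>finite S\<close> k
      by simp
    finally have hit: "1 / (6 * real k) \<le> \<dots>" .
    have "miss x = {V. \<forall>i\<in>{1..r}. V i \<notin> {U. (\<exists>e\<in>S. e \<subseteq> U) \<and> U \<inter> X = {}}}"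
      unfolding miss_def x(1) by auto
    then show ?thesis using prob_random_subsets_all_miss_le[OF hit] by simp
  qed
  then have "measure_pmf.prob ?M (\<Union>x\<in>I. miss x) \<le> real (card I) * exp (- (1 / (6 * real k) * real r))"
    by (intro prob_UN_le_card_mult finite_subset[OF Isub fin]) auto
  also have "\<dots> \<le> real n ^ (3 * k) * exp (- (30 * real k * L))"
  proof (rule mult_mono)
    \<comment> \<open>\<open>200 / 6\<close> is rounded down to 30; the count
      \<open>n ^ (3 * k)\<close> then takes \<open>3 * k * L\<close> of the exponent.\<close>
    have "30 * real k * L \<le> 1 / (6 * real k) * (200 * real k ^ 2 * L)"
      using assms(4) L(1) by (simp add: field_simps power2_eq_square)
    also have "\<dots> \<le> 1 / (6 * real k) * real r"
      using assms(5) unfolding L_def by (intro mult_left_mono) auto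
    finally show "exp (- (1 / (6 * real k) * real r)) \<le> exp (- (30 * real k * L))" by simp
  qed (use cardI in auto)
  also have "\<dots> = exp (- (27 * real k * L))"
    by (simp add: L(2) exp_of_nat_mult[symmetric] exp_add[symmetric] algebra_simps)
  also have "\<dots> \<le> exp (- (3 * L))"
  proof -
    have "1 * L \<le> real k * L" using assms(4) L(1) by (intro mult_right_mono) auto
    then have "3 * L \<le> 27 * real k * L" using L(1) by linarith
    then show ?thesis by simp
  qed
  also have "\<dots> = 1 / real n ^ 3"
    unfolding L(2) by (simp add: exp_of_nat_mult[symmetric] exp_minus inverse_eq_divide)
  also have "(\<Union>x\<in>I. miss x) = {V. \<exists>X S. X \<subseteq> W \<and> card X < k \<and> card S = k \<and> (\<forall>e\<in>S. e \<subseteq> W - X \<and> card e = 2) \<and>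
         (\<forall>i\<in>{1..r}. \<forall>e\<in>S. \<not> (e \<subseteq> V i \<and> V i \<inter> X = {}))}"
    unfolding I_def miss_def by blast
  finally show ?thesis .
qed

text \<open>One fixed set \<open>Y u v\<close> per pair leaves only \<open>n ^ 2\<close> events, so
  a hit probability of merely \<open>1 / (9 * k ^ 2)\<close> per sample suffices.\<close>

lemma prob_separated_pair_missed_le:
  assumes "finite W" "n = card W" "n \<ge> 2" "k \<ge> 1" "real r \<ge> 200 * real k ^ 2 * ln (real n)"
  shows "measure_pmf.prob (random_subsets r W (1 / real k))
      {V. \<exists>u\<in>W. \<exists>v\<in>W. u \<noteq> v \<and> Y u v \<subseteq> W - {u, v} \<and> card (Y u v) \<le> 2 * (k - 1) \<and>
         (\<forall>i\<in>{1..r}. \<not> ({u, v} \<subseteq> V i \<and> V i \<inter> Y u v = {}))}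
    \<le> 1 / real n ^ 3"
proof -
  let ?M = "random_subsets r W (1 / real k)"
  define I where "I = {(u, v). u \<in> W \<and> v \<in> W \<and> u \<noteq> v \<and> Y u v \<subseteq> W - {u, v} \<and> card (Y u v) \<le> 2 * (k - 1)}"
  define miss where "miss = (\<lambda>(u, v). {V. \<forall>i\<in>{1..r}. V i \<notin> {U. {u, v} \<subseteq> U \<and> U \<inter> Y u v = {}}})"
  define L where "L = ln (real n)"
  have L: "L \<ge> 0" "real n = exp L" using assms(3) by (auto simp: L_def)
  have Isub: "I \<subseteq> W \<times> W" unfolding I_def by auto
  have "card I \<le> n ^ 2"
    using card_mono[OF _ Isub] assms(1,2) by (simp add: card_cartesian_product power2_eq_square)
  then have cardI: "real (card I) \<le> real n ^ 2"
    by (metis of_nat_le_iff of_nat_power)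
  have k: "real k \<ge> 1" using assms(4) by simp
  have "measure_pmf.prob ?M (miss x) \<le> exp (- (1 / (9 * real k ^ 2) * real r))" if "x \<in> I" for x
  proof -
    obtain u v where "x = (u, v)" by (cases x)
    with that have x: "x = (u, v)" "u \<in> W" "v \<in> W" "u \<noteq> v" "Y u v \<subseteq> W - {u, v}" "card (Y u v) \<le> 2 * (k - 1)"
      unfolding I_def by auto
    have "1 / (9 * real k ^ 2) = (1 / real k) ^ 2 * (1 / 9)" by (simp add: power_one_over)
    also have "\<dots> \<le> (1 / real k) ^ 2 * (1 - 1 / real k) ^ card (Y u v)"
      using one_minus_inverse_power_double_ge[OF assms(4) x(6)] by (intro mult_left_mono) auto
    also have "\<dots> = measure_pmf.prob (random_subset W (1 / real k)) {U. {u, v} \<subseteq> U \<and> U \<inter> Y u v = {}}"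
      by (subst prob_random_subset_contains_avoids)
        (use x k assms(1) in \<open>auto simp: power2_eq_square\<close>)
    finally show ?thesis
      unfolding miss_def x(1) prod.case by (rule prob_random_subsets_all_miss_le)
  qed
  then have "measure_pmf.prob ?M (\<Union>x\<in>I. miss x) \<le> real (card I) * exp (- (1 / (9 * real k ^ 2) * real r))"
    by (intro prob_UN_le_card_mult finite_subset[OF Isub]) (use assms(1) in auto)
  also have "\<dots> \<le> real n ^ 2 * exp (- (5 * L))"
  proof (rule mult_mono)
    \<comment> \<open>\<open>200 / 9\<close> exceeds 5, and 2 of these 5 pay for the
      \<open>n ^ 2\<close> pairs.\<close>
    have "5 * L \<le> 1 / (9 * real k ^ 2) * (200 * real k ^ 2 * L)"
      using k L(1) by (simp add: field_simps)
    also have "\<dots> \<le> 1 / (9 * real k ^ 2) * real r"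
      using assms(5) unfolding L_def by (intro mult_left_mono) auto
    finally show "exp (- (1 / (9 * real k ^ 2) * real r)) \<le> exp (- (5 * L))" by simp
  qed (use cardI in auto)
  also have "\<dots> = 1 / real n ^ 3"
    unfolding L(2) by (simp add: exp_of_nat_mult[symmetric] exp_add[symmetric] exp_minus[symmetric] inverse_eq_divide[symmetric])
  also have "(\<Union>x\<in>I. miss x) = {V. \<exists>u\<in>W. \<exists>v\<in>W. u \<noteq> v \<and> Y u v \<subseteq> W - {u, v} \<and> card (Y u v) \<le> 2 * (k - 1) \<and>
         (\<forall>i\<in>{1..r}. \<not> ({u, v} \<subseteq> V i \<and> V i \<inter> Y u v = {}))}"
    unfolding I_def miss_def by auto
  finally show ?thesis .
qed

text \<open>Rounding up adds at most 1, which \<open>2 * k ^ 2 * ln n\<close> covers since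
  \<open>ln 2\<close> is at least 2/3.\<close>

lemma num_samples_bounds:
  assumes "n \<ge> 2" "k \<ge> 1"
  shows "real (num_samples k n) \<ge> 200 * real k ^ 2 * ln (real n)"
    "real (num_samples k n) \<le> 202 * real k ^ 2 * ln (real n)"
proof -
  have ln: "ln (real n) \<ge> 2 / 3"
  proof -
    have "ln 2 \<le> ln (real n)" using assms(1) by simp
    then show ?thesis using ln2_ge_two_thirds by linarith
  qed
  have "1 / 2 \<le> ln (real n) * 1" using ln by simp
  also have "\<dots> \<le> ln (real n) * real k ^ 2"
    using assms ln by (intro mult_left_mono) (auto simp: one_le_power)
  finally have one: "1 \<le> 2 * real k ^ 2 * ln (real n)" by (simp add: mult_ac)
  have "real (num_samples k n) = of_int \<lceil>200 * real k ^ 2 * ln (real n)\<rceil>"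
    using one unfolding num_samples_def by simp
  then show "real (num_samples k n) \<ge> 200 * real k ^ 2 * ln (real n)"
    "real (num_samples k n) \<le> 202 * real k ^ 2 * ln (real n)"
    using one le_of_int_ceiling[of "200 * real k ^ 2 * ln (real n)"]
      of_int_ceiling_le_add_one[of "200 * real k ^ 2 * ln (real n)"] by linarith+
qed

section \<open>Combining the three failure events\<close>

theorem theorem3p1:
  "\<exists>C>0. \<exists>c>0. \<forall>(G :: ('v, 'e) mgraph) (k :: nat) (n :: nat) (r :: nat).
     finite_mgraph G \<and> verts G \<noteq> {} \<and> n = card (verts G) \<and> k \<ge> 1 \<and> r = num_samples k n \<longrightarrow>
     measure_pmf.prob (random_subsets r (verts G) (1 / real k))
       {V. \<forall>T. (\<forall>i\<in>{1..r}. spanning_forest (T i) (induced G (V i))) \<longrightarrow>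
             real (card (edges (union_subgraph G r T))) \<le> C * real k * real n * ln (real n) \<and>
             certificate k G (union_subgraph G r T)}
     \<ge> 1 - 1 / real n powr c"
proof -
  have "measure_pmf.prob (random_subsets r (verts G) (1 / real k))
       {V. \<forall>T. (\<forall>i\<in>{1..r}. spanning_forest (T i) (induced G (V i))) \<longrightarrow>
             real (card (edges (union_subgraph G r T))) \<le> 606 * real k * real n * ln (real n) \<and>
             certificate k G (union_subgraph G r T)}
     \<ge> 1 - 1 / real n powr 1" (is "measure_pmf.prob ?M ?good \<ge> _")
    if G: "finite_mgraph G" "verts G \<noteq> {}" and n: "n = card (verts G)" and k: "k \<ge> 1"
      and r: "r = num_samples k n"
    for G :: "('v, 'e) mgraph" and k n r :: nat
  proof (cases "n = 1")
    case False
    have fin: "finite (verts G)" using G(1) unfolding finite_mgraph_def by simp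
    then have n2: "n \<ge> 2" using False G(2) n card_0_eq[of "verts G"] by linarith
    note r_bounds = num_samples_bounds[OF n2 k, folded r]
    define m where "m = real (card (verts G)) * (1 / real k) * real r"
    txt \<open>Fixing one separator per pair keeps the union bound over only \<open>n\<^sup>2\<close> events.\<close>
    define Y where "Y = (\<lambda>u v. SOME Y. separates G u v Y \<and> card Y \<le> 2 * (k - 1))"
    define many where "many = {V. 3 * m \<le> real (\<Sum>i\<in>{1..r}. card (V i :: 'v set))}"
    define pairs_missed where "pairs_missed = {V. \<exists>X S. X \<subseteq> verts G \<and> card X < k \<and> card S = k \<and>
         (\<forall>e\<in>S. e \<subseteq> verts G - X \<and> card e = 2) \<and>
         (\<forall>i\<in>{1..r}. \<forall>e\<in>S. \<not> (e \<subseteq> V i \<and> V i \<inter> X = {}))}"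
    define separated_missed where "separated_missed = {V. \<exists>u\<in>verts G. \<exists>v\<in>verts G. u \<noteq> v \<and>
         Y u v \<subseteq> verts G - {u, v} \<and> card (Y u v) \<le> 2 * (k - 1) \<and>
         (\<forall>i\<in>{1..r}. \<not> ({u, v} \<subseteq> V i \<and> V i \<inter> Y u v = {}))}"
    have "measure_pmf.prob ?M many \<le> exp (- m)"
      unfolding many_def m_def using fin k by (intro prob_sum_card_random_subsets_ge) auto
    also have "\<dots> \<le> exp (- (3 * ln (real n)))"
    proof -
      \<comment> \<open>\<open>m = n * r / k\<close> is at least \<open>200 * k * n * ln n\<close>,
        ample for the common bound \<open>1 / n ^ 3\<close>.\<close>
      have "3 * ln (real n) \<le> 1 * (1 * (200 * ln (real n)))" using n2 by simp
      also have "\<dots> \<le> real n * (real k * (200 * ln (real n)))"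
        using n2 k by (intro mult_mono) auto
      also have "\<dots> = real n * (1 / real k) * (200 * real k ^ 2 * ln (real n))"
        using k by (simp add: power2_eq_square)
      also have "\<dots> \<le> m"
        unfolding m_def n[symmetric] using r_bounds(1) by (intro mult_left_mono) auto
      finally show ?thesis by simp
    qed
    also have "\<dots> = 1 / real n ^ 3"
      using n2 by (simp add: exp_minus inverse_eq_divide exp_of_nat_mult[of 3, simplified])
    finally have many: "measure_pmf.prob ?M many \<le> 1 / real n ^ 3" .
    have pairs: "measure_pmf.prob ?M pairs_missed \<le> 1 / real n ^ 3"
      unfolding pairs_missed_def by (rule prob_k_pairs_all_missed_le[OF fin n n2 k r_bounds(1)])
    have separated: "measure_pmf.prob ?M separated_missed \<le> 1 / real n ^ 3"
      unfolding separated_missed_def by (rule prob_separated_pair_missed_le[OF fin n n2 k r_bounds(1)])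

    \<comment> \<open>Outside the bad events both claims hold for every \<open>T\<close>, so the
      forests may depend arbitrarily on the samples.\<close>
    have good: "V \<in> ?good" if V: "V \<in> set_pmf ?M" "V \<notin> many" "V \<notin> pairs_missed" "V \<notin> separated_missed" for V
    proof (intro CollectI allI impI conjI)
      fix T assume T: "\<forall>i\<in>{1..r}. spanning_forest (T i) (induced G (V i))"
      let ?H = "union_subgraph G r T"
      have Vi: "V i \<subseteq> verts G" if "i \<in> {1..r}" for i
        using set_pmf_random_subsets[OF fin V(1) that] .
      have "real (card (edges ?H)) \<le> real (\<Sum>i\<in>{1..r}. card (V i))"
        using card_edges_union_subgraph[OF G(1) Vi, where r = r and T = T] T by (simp only: of_nat_le_iff)
      also have "\<dots> \<le> 3 * m" using V(2) unfolding many_def by simp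
      \<comment> \<open>The constant 606 of the edge bound is \<open>3 * 202\<close>.\<close>
      also have "\<dots> \<le> 3 * (real n * (1 / real k) * (202 * real k ^ 2 * ln (real n)))"
        unfolding m_def n[symmetric] using r_bounds(2) by (intro mult_left_mono) auto
      also have "\<dots> = 606 * real k * real n * ln (real n)"
        using k by (simp add: power2_eq_square)
      finally show "real (card (edges ?H)) \<le> 606 * real k * real n * ln (real n)" .
      have sub: "subgraph ?H G" "verts ?H = verts G"
        using subgraph_union_subgraph[OF G(1), where r = r and T = T and V = V] T by (auto simp: union_subgraph_def)
      have "k_vertex_connected k ?H" if kG: "k_vertex_connected k G"
      proof (rule k_vertex_connected_union_subgraph[OF G k kG])
        show "spanning_forest (T i) (induced G (V i))" if "i \<in> {1..r}" for i
          using T that by blast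
        show "\<exists>i\<in>{1..r}. \<exists>e\<in>S. e \<subseteq> V i \<and> V i \<inter> X = {}"
          if "X \<subseteq> verts G" "card X < k" "card S = k" "\<And>e. e \<in> S \<Longrightarrow> e \<subseteq> verts G - X \<and> card e = 2" for X S
          using V(3) that unfolding pairs_missed_def by blast
        show "\<exists>Y'. separates G u v Y' \<and> (\<exists>i\<in>{1..r}. {u, v} \<subseteq> V i \<and> V i \<inter> Y' = {})"
          if uv: "u \<in> verts G" "v \<in> verts G" "u \<noteq> v" and Z: "separates G u v Z" "card Z \<le> 2 * (k - 1)" for u v Z
        proof -
          \<comment> \<open>\<open>Z\<close> only witnesses that a small separator exists, so that
            the chosen \<open>Y u v\<close> is one.\<close>
          have "\<exists>Y. separates G u v Y \<and> card Y \<le> 2 * (k - 1)" using Z by blast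
          then have Y: "separates G u v (Y u v)" "card (Y u v) \<le> 2 * (k - 1)"
            using someI_ex[of "\<lambda>Y. separates G u v Y \<and> card Y \<le> 2 * (k - 1)"] unfolding Y_def by auto
          then have "Y u v \<subseteq> verts G - {u, v}" unfolding separates_def by blast
          then have "\<exists>i\<in>{1..r}. {u, v} \<subseteq> V i \<and> V i \<inter> Y u v = {}"
            using V(4) uv Y(2) unfolding separated_missed_def by blast
          then show ?thesis using Y(1) by blast
        qed
      qed
      moreover have "k_vertex_connected k G" if "k_vertex_connected k ?H"
        using vertex_connectivity_subgraph_le[OF fin G(2) sub] that unfolding k_vertex_connected_def by simp
      ultimately show "certificate k G ?H"
        unfolding certificate_def using sub by blast
    qed
    let ?bad = "many \<union> pairs_missed \<union> separated_missed"
    \<comment> \<open>On the support every sample is a set of vertices of \<open>G\<close>, as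
      \<open>good\<close> requires.\<close>
    have "measure_pmf.prob ?M (- ?good) = measure_pmf.prob ?M (- ?good \<inter> set_pmf ?M)"
      by (simp only: measure_Int_set_pmf)
    also have "\<dots> \<le> measure_pmf.prob ?M ?bad"
      by (rule measure_pmf.finite_measure_mono) (use good in blast, simp)
    also have "\<dots> \<le> measure_pmf.prob ?M many + measure_pmf.prob ?M pairs_missed + measure_pmf.prob ?M separated_missed"
      using measure_Un_le[of "many \<union> pairs_missed" ?M separated_missed] measure_Un_le[of many ?M pairs_missed]
      by simp
    also have "\<dots> \<le> 3 / real n ^ 3" using many pairs separated by simp
    also have "\<dots> \<le> 1 / real n"
    proof -
      have "2 * 2 \<le> real n * real n" using n2 by (intro mult_mono) auto
      then show ?thesis using n2 by (simp add: field_simps power3_eq_cube)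
    qed
    finally have "measure_pmf.prob ?M (- ?good) \<le> 1 / real n" .
    moreover have "measure_pmf.prob ?M (- ?good) = 1 - measure_pmf.prob ?M ?good"
      using measure_pmf.prob_compl[of ?good ?M] by (simp add: Compl_eq_Diff_UNIV)
    ultimately show ?thesis using n2 by simp
  \<comment> \<open>For \<open>n = 1\<close> the claimed lower bound is 0.\<close>
  qed simp
  then show ?thesis
    by (intro exI[of _ 606] exI[of _ 1] conjI allI impI) auto
qed

end
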